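(* Let $\alpha,\beta,\gamma$ be positive irrational numbers with $\alpha+\beta+\gamma=1$, $\beta<1/2$ and $\alpha<\gamma$. Let $(a(n))_{n\in\mathbb{N}}$, $(b(n))_{n\in\mathbb{N}}$, $(c(n))_{n\in\mathbb{N}}$ be the Webster sequences of densities $\alpha,\beta,\gamma$, respectively. Then there exist strictly increasing sequences $(\widetilde{a}(n))_{n\in\mathbb{N}}$, $(\widetilde{b}(n))_{n\in\mathbb{N}}$, $(\widetilde{c}(n))_{n\in\mathbb{N}}$ of positive integers whose sets of values partition $\mathbb{N}$ and which satisfy, for all $n\in\mathbb{N}$, $$\widetilde{a}(n)=a(n),\qquad \widetilde{b}(n)-b(n)\in\{-1,0,1\},\qquad \widetilde{c}(n)-c(n)\in\{-1,0,1\}.$$ That is, $\mathbb{N}$ can be partitioned into the Webster sequence of density $\alpha$ and two almost Webster sequences of densities $\beta$ and $\gamma$.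
   Context: $\mathbb{N}=\{1,2,3,\dots\}$. For $x\in(0,1)$ irrational, the Webster sequence of density $x$ is the sequence whose $n$th term is $\lceil (n-1/2)/x\rceil$, $n\in\mathbb{N}$. A sequence $(\widetilde{s}(n))$ is an almost Webster sequence of density $x$ if $|\widetilde{s}(n)-s(n)|\le 1$ for all $n$, where $(s(n))$ is the Webster sequence of density $x$. *)

theory Defs
  imports Complex_Main
begin

(* Indices run over n >= 1; the value at n = 0 is junk and is never used. *)
definition webster :: "real \<Rightarrow> nat \<Rightarrow> int" where
  "webster x n = \<lceil>(real n - 1 / 2) / x\<rceil>"

end

(* Let W x N = floor (x N + 1/2) be the counting function of the Webster sequence of density x, and
   put r N = N - W alpha N. A sequence is almost Webster of density x iff its counting function F
   satisfies W x (N - 1) <= F N <= W x (N + 1). Hence one has to find F, the counting function of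
   the second sequence, with increments between 0 and those of r, subject to bounds
   L N <= F N <= U N, where r - F counts the third sequence. Such an F exists as soon as L and U
   are compatible for each pair of times, and for this it is enough that alpha < 1/2. *)
theory Submission
  imports Defs
begin

section \<open>Increasing sequences as inverses of counting functions\<close>

text \<open>A Galois connection: \<open>e n\<close> is the first time at which \<open>F\<close>
  reaches level \<open>n\<close>. Bounds on times and on levels thus translate into each other. The
  value \<open>e 0\<close> stays free.\<close>

definition enumerates :: "(nat \<Rightarrow> nat) \<Rightarrow> (nat \<Rightarrow> int) \<Rightarrow> bool" where
  "enumerates e F \<longleftrightarrow> (\<forall>n\<ge>1. \<forall>N. e n \<le> N \<longleftrightarrow> int n \<le> F N)"

lemma enumeratesD: "enumerates e F \<Longrightarrow> n \<ge> 1 \<Longrightarrow> e n \<le> N \<longleftrightarrow> int n \<le> F N"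
  unfolding enumerates_def by blast

lemma enumerates_exists:
  assumes "mono F" and unbounded: "\<And>n. \<exists>N. int n \<le> F N"
  shows "\<exists>e. enumerates e F"
proof -
  define e where "e n = (LEAST N. int n \<le> F N)" for n
  have "int n \<le> F (e n)" for n
    unfolding e_def using unbounded by (rule LeastI_ex)
  then have "e n \<le> N \<longleftrightarrow> int n \<le> F N" for n N
    using monoD[OF \<open>mono F\<close>, of "e n" N] by (auto simp: e_def intro: Least_le order_trans)
  then show ?thesis
    unfolding enumerates_def by blast
qed

lemma enumerates_image:
  assumes e: "enumerates e F" and F0: "F 0 = 0" and "mono F"
  shows "e ` {1..} = {N. 1 \<le> N \<and> F (N - 1) < F N}"
proof (intro equalityI subsetI)
  fix N assume "N \<in> e ` {1..}"
  then obtain n where n: "n \<ge> 1" "N = e n" by auto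
  have "int n \<le> F N" using enumeratesD[OF e n(1)] n(2) by blast
  moreover from this have "N \<noteq> 0" using F0 n(1) by (intro notI) simp
  moreover from this have "\<not> int n \<le> F (N - 1)"
    using enumeratesD[OF e n(1), of "N - 1"] n(2) by auto
  ultimately show "N \<in> {N. 1 \<le> N \<and> F (N - 1) < F N}" by auto
next
  fix N assume N: "N \<in> {N. 1 \<le> N \<and> F (N - 1) < F N}"
  \<comment> \<open>Every level first reached at time \<open>N\<close> would serve as the index; the
    top one, \<open>F N\<close>, is positive because \<open>F\<close> starts at 0.\<close>
  define n where "n = nat (F N)"
  have "0 \<le> F (N - 1)" using monoD[OF \<open>mono F\<close>, of 0 "N - 1"] F0 by simp
  then have n: "n \<ge> 1" "int n = F N" using N by (auto simp: n_def)
  have "e n \<le> N" "\<not> e n \<le> N - 1" using enumeratesD[OF e n(1)] n(2) N by auto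
  then have "N = e n" by linarith
  then show "N \<in> e ` {1..}" using n(1) by auto
qed

text \<open>Unit steps let \<open>F\<close> reach each level without jumping over it, so
  \<open>F (e m)\<close> does not exceed \<open>m\<close> and any higher level is reached strictly
  later.\<close>

lemma enumerates_strict_mono_on:
  assumes e: "enumerates e F" and F0: "F 0 = 0" and step: "\<And>N. F (Suc N) \<le> F N + 1"
  shows "strict_mono_on {1..} e"
proof (rule strict_mono_onI)
  fix m n :: nat assume m: "m \<in> {1..}" and mn: "m < n"
  have "int m \<le> F (e m)" using enumeratesD[OF e, of m "e m"] m by simp
  then obtain k where k: "e m = Suc k" using F0 m by (cases "e m") auto
  have "\<not> int m \<le> F k" using enumeratesD[OF e, of m k] m k by auto
  then have "F (e m) \<le> int m" using step[of k] k by simp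
  then show "e m < e n" using enumeratesD[OF e, of n "e m"] m mn by auto
qed

text \<open>Sandwiching \<open>F\<close> between unit time shifts of \<open>G\<close> moves the
  first time at level \<open>n\<close> by at most one in either direction.\<close>

lemma enumerates_shift:
  assumes e: "enumerates e F" and w: "enumerates w G" and n: "n \<ge> 1"
    and lo: "\<And>N. G (N - 1) \<le> F N" and hi: "\<And>N. F N \<le> G (N + 1)"
  shows "int (e n) - int (w n) \<in> {-1, 0, 1}"
proof -
  have "int n \<le> G (w n)" "int n \<le> F (e n)"
    using enumeratesD[OF w n] enumeratesD[OF e n] by blast+
  then have "int n \<le> F (w n + 1)" "int n \<le> G (e n + 1)"
    using lo[of "w n + 1"] hi[of "e n"] by simp_all
  then have "e n \<le> w n + 1" "w n \<le> e n + 1"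
    using enumeratesD[OF w n] enumeratesD[OF e n] by blast+
  then show ?thesis by auto
qed

section \<open>Integer paths between two barriers\<close>

text \<open>The hypotheses on \<open>L\<close> and \<open>U\<close> are also necessary:
  \<open>F\<close> never decreases (\<open>LU\<close>), grows no faster than \<open>r\<close>
  (\<open>LUr\<close>) and starts at 0 (\<open>Lr\<close>, \<open>U0\<close>). The path is built
  greedily: it stays level while that is safe and otherwise rises with \<open>r\<close>.\<close>

lemma constrained_path_exists:
  fixes r L U :: "nat \<Rightarrow> int"
  assumes r0: "r 0 = 0" and step: "\<And>N. r (Suc N) - r N \<in> {0, 1}"
    and LU: "\<And>M N. M \<le> N \<Longrightarrow> L M \<le> U N"
    and LUr: "\<And>M N. M \<le> N \<Longrightarrow> L N - U M \<le> r N - r M"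
    and Lr: "\<And>N. L N \<le> r N" and U0: "\<And>N. 0 \<le> U N"
  shows "\<exists>F. F 0 = 0 \<and> (\<forall>N. F (Suc N) - F N \<in> {0..r (Suc N) - r N} \<and> L N \<le> F N \<and> F N \<le> U N)"
proof -
  have "r N \<le> r (Suc N)" for N
    using step[of N] by auto
  then have "mono r"
    by (simp add: mono_iff_le_Suc)
  \<comment> \<open>The values at time N from which no later bound is violated by the extreme continuations.\<close>
  define good where "good N v \<longleftrightarrow> (\<forall>M\<ge>N. L M \<le> v + (r M - r N) \<and> v \<le> U M)" for N v
  have ext: "\<exists>v'. good (Suc N) v' \<and> v' - v \<in> {0..r (Suc N) - r N}" if v: "good N v" for N v
  proof (cases "r (Suc N) = r N \<or> good (Suc N) v")
    case True
    then have "good (Suc N) v" using v by (auto simp: good_def)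
    then show ?thesis using step[of N] by (intro exI[of _ v]) auto
  next
    case False
    then have r1: "r (Suc N) = r N + 1" using step[of N] by auto
    \<comment> \<open>The upper bounds on \<open>v\<close> are inherited from
      \<open>good N v\<close>, so what fails must be a lower bound.\<close>
    from False v obtain M where M: "M \<ge> Suc N" "v + (r M - r (Suc N)) < L M"
      by (force simp: good_def)
    \<comment> \<open>The lower bound at \<open>M\<close> that forces the rise also shows it to be
      safe: it is compatible with upper bounds up to time \<open>M\<close> by \<open>LUr\<close>,
      and with later ones by \<open>LU\<close>.\<close>
    have "v + 1 \<le> U K" if K: "K \<ge> Suc N" for K
    proof (cases "K \<le> M")
      case True
      have "r (Suc N) \<le> r K" using monoD[OF \<open>mono r\<close> K] .
      then show ?thesis using LUr[OF True] M by linarith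
    next
      case False
      have "r (Suc N) \<le> r M" using monoD[OF \<open>mono r\<close> M(1)] .
      then show ?thesis using LU[of M K] False M by linarith
    qed
    then have "good (Suc N) (v + 1)" using v r1 by (auto simp: good_def)
    then show ?thesis using r1 by (intro exI[of _ "v + 1"]) auto
  qed
  have "good 0 0" using Lr U0 r0 by (simp add: good_def)
  then have "\<exists>F. \<forall>N. (good N (F N) \<and> (N = 0 \<longrightarrow> F N = 0))
      \<and> F (Suc N) - F N \<in> {0..r (Suc N) - r N}"
    using ext by (intro dependent_nat_choice) fastforce+
  then obtain F where F: "\<And>N. good N (F N)" "F 0 = 0"
    "\<And>N. F (Suc N) - F N \<in> {0..r (Suc N) - r N}" by blast
  have "L N \<le> F N \<and> F N \<le> U N" for N
    using F(1)[of N] unfolding good_def by fastforce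
  with F show ?thesis by blast
qed

section \<open>Counting functions of Webster sequences and their rounding errors\<close>

definition webster_count :: "real \<Rightarrow> nat \<Rightarrow> int" where
  "webster_count x N = \<lfloor>x * real N + 1 / 2\<rfloor>"

lemma webster_count_0 [simp]: "webster_count x 0 = 0"
  by (simp add: webster_count_def)

lemma webster_count_bounds:
  "real_of_int (webster_count x N) \<le> x * real N + 1 / 2"
  "x * real N - 1 / 2 < real_of_int (webster_count x N)"
  unfolding webster_count_def by linarith+

lemma mono_webster_count: "x \<ge> 0 \<Longrightarrow> mono (webster_count x)"
  unfolding webster_count_def by (intro monoI floor_mono add_right_mono mult_left_mono) auto

lemma webster_count_Suc_le:
  assumes "x \<le> 1"
  shows "webster_count x (Suc N) \<le> webster_count x N + 1"
proof -
  have "x * real (Suc N) + 1 / 2 \<le> (x * real N + 1 / 2) + 1"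
    using assms by (simp add: algebra_simps)
  then show ?thesis unfolding webster_count_def by linarith
qed

lemma webster_pos: "x > 0 \<Longrightarrow> n \<ge> 1 \<Longrightarrow> webster x n > 0"
  by (simp add: webster_def)

lemma enumerates_webster:
  assumes "x > 0"
  shows "enumerates (\<lambda>n. nat (webster x n)) (webster_count x)"
proof -
  have "nat (webster x n) \<le> N \<longleftrightarrow> int n \<le> webster_count x N" if "n \<ge> 1" for n N
  proof -
    have "nat (webster x n) \<le> N \<longleftrightarrow> webster x n \<le> int N" by linarith
    also have "\<dots> \<longleftrightarrow> (real n - 1 / 2) / x \<le> real N"
      unfolding webster_def by (simp add: ceiling_le_iff)
    also have "\<dots> \<longleftrightarrow> real n \<le> x * real N + 1 / 2"
      using assms by (auto simp: divide_le_eq mult.commute)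
    also have "\<dots> \<longleftrightarrow> int n \<le> webster_count x N"
      unfolding webster_count_def by (simp add: le_floor_iff)
    finally show ?thesis .
  qed
  then show ?thesis unfolding enumerates_def by blast
qed

text \<open>For \<open>N \<le> M + 2\<close> the left side is at most 0 and the right side at least
  0. Otherwise put \<open>k = N - M\<close>: the four rounding errors total less than 2, while
  shortening the interval for \<open>x\<close> saves \<open>2 * x\<close> and the share of
  \<open>y\<close> is at least \<open>2 * y\<close>. The excess over \<open>k\<close> is thus below
  \<open>2 - 2 * (x + y) = 2 * a < 1\<close>, and integrality finishes.\<close>

lemma webster_count_diff_le:
  assumes "x > 0" "y > 0" "a \<ge> 0" "a + x + y = 1" "a < 1 / 2" "M \<le> N"
  shows "webster_count x (N - 1) - webster_count x (M + 1)
    \<le> (int N - webster_count a N) - (int M - webster_count a M)"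
proof (cases "N \<le> M + 2")
  case True
  have "webster_count x (N - 1) \<le> webster_count x (M + 1)"
    using True assms(1) by (intro monoD[OF mono_webster_count]) auto
  moreover have "webster_count a N - webster_count a M \<le> int (N - M)"
    using \<open>M \<le> N\<close>
  proof (induction rule: dec_induct)
    case (step n)
    then show ?case using webster_count_Suc_le[of a n] assms by simp
  qed simp
  ultimately show ?thesis using assms by simp
next
  case False
  define k where "k = real N - real M"
  have k: "k \<ge> 2" "real N = real M + k" using False by (auto simp: k_def)
  have "y * k \<ge> y * 2" using k assms(2) by (intro mult_left_mono) auto
  moreover have "(a + x + y) * k = k" by (simp add: assms)
  ultimately have "a * k + x * k \<le> k - 2 * y" by (simp add: algebra_simps)
  moreover have "real (N - 1) = real M + k - 1" using False k by simp
  ultimately have "real_of_int (webster_count x (N - 1) - webster_count x (M + 1)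
      + webster_count a N - webster_count a M) < k + 1"
    using webster_count_bounds[of x "N - 1"] webster_count_bounds[of x "M + 1"]
      webster_count_bounds[of a N] webster_count_bounds[of a M] assms k
    by (simp add: algebra_simps)
  then show ?thesis unfolding k_def by linarith
qed

text \<open>Three roundings add at most 3/2 and the time shift removes \<open>x + y = 1 - a\<close>,
  so the excess over \<open>N\<close> is at most \<open>a + 1 / 2 < 1\<close>. At
  \<open>N = 0\<close> truncated subtraction gives no shift, but all counts vanish.\<close>

lemma webster_counts_le:
  assumes "x > 0" "y > 0" "a + x + y = 1" "a < 1 / 2"
  shows "webster_count a N + webster_count x (N - 1) + webster_count y (N - 1) \<le> int N"
proof (cases N)
  case (Suc K)
  have "(a + x + y) * real K = real K" by (simp add: assms)
  then have "real_of_int (webster_count a N + webster_count x K + webster_count y K) < real N + 1"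
    using webster_count_bounds[of a N] webster_count_bounds[of x K] webster_count_bounds[of y K]
      assms Suc by (simp add: algebra_simps)
  then show ?thesis using Suc by simp
qed simp

lemma webster_counts_ge:
  assumes "x > 0" "y > 0" "a + x + y = 1" "a < 1 / 2"
  shows "int N \<le> webster_count a N + webster_count x (N + 1) + webster_count y (N + 1)"
proof -
  have "(a + x + y) * real N = real N" by (simp add: assms)
  then have "real N - 1
      < real_of_int (webster_count a N + webster_count x (N + 1) + webster_count y (N + 1))"
    using webster_count_bounds[of a N] webster_count_bounds[of x "N + 1"]
      webster_count_bounds[of y "N + 1"] assms by (simp add: algebra_simps)
  then show ?thesis by linarith
qed

lemma webster_count_unbounded:
  assumes "x > 0"
  shows "\<exists>N. int n \<le> webster_count x N"
proof -
  obtain N where "real n < real N * x" using reals_Archimedean3[OF assms] by blast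
  then show ?thesis unfolding webster_count_def
    by (intro exI[of _ N]) (simp add: le_floor_iff mult.commute)
qed

section \<open>From counting functions to the partition\<close>

text \<open>Describing the values as the jump times of \<open>F\<close> lets the partition property
  be checked on increments of counting functions.\<close>

lemma almost_webster_enumeration:
  assumes "x > 0" and F0: "F 0 = 0"
    and step: "\<And>N. F (Suc N) - F N \<in> {0, 1}"
    and lo: "\<And>N. webster_count x (N - 1) \<le> F N" and hi: "\<And>N. F N \<le> webster_count x (N + 1)"
  shows "\<exists>e. strict_mono_on {1..} e \<and> e ` {1..} = {N. 1 \<le> N \<and> F (N - 1) < F N} \<and>
    (\<forall>n\<ge>1. int (e n) - webster x n \<in> {-1, 0, 1})"
proof -
  have step': "F N \<le> F (Suc N)" "F (Suc N) \<le> F N + 1" for N using step[of N] by auto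
  have "mono F" using step' by (simp add: mono_iff_le_Suc)
  moreover have "\<exists>N. int n \<le> F N" for n
    using webster_count_unbounded[OF \<open>x > 0\<close>, of n] lo by (metis diff_Suc_1 order_trans)
  ultimately obtain e where e: "enumerates e F" using enumerates_exists by blast
  have "int (e n) - webster x n \<in> {-1, 0, 1}" if "n \<ge> 1" for n
    using enumerates_shift[OF e enumerates_webster[OF \<open>x > 0\<close>] that lo hi]
      webster_pos[OF \<open>x > 0\<close> that] by simp
  with enumerates_image[OF e F0 \<open>mono F\<close>] enumerates_strict_mono_on[of e F, OF e F0 step'(2)]
  show ?thesis by blast
qed

theorem theorem4:
  fixes \<alpha> \<beta> \<gamma> :: real
  assumes "\<alpha> > 0" and "\<beta> > 0" and "\<gamma> > 0"
    and "\<alpha> \<notin> \<rat>" and "\<beta> \<notin> \<rat>" and "\<gamma> \<notin> \<rat>"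
    and "\<alpha> + \<beta> + \<gamma> = 1"
    and "\<beta> < 1 / 2"
    and "\<alpha> < \<gamma>"
  shows "\<exists>a b c :: nat \<Rightarrow> nat.
    strict_mono_on {1..} a \<and> strict_mono_on {1..} b \<and> strict_mono_on {1..} c \<and>
    a ` {1..} \<union> b ` {1..} \<union> c ` {1..} = {1..} \<and>
    a ` {1..} \<inter> b ` {1..} = {} \<and>
    a ` {1..} \<inter> c ` {1..} = {} \<and>
    b ` {1..} \<inter> c ` {1..} = {} \<and>
    (\<forall>n\<ge>1. int (a n) = webster \<alpha> n \<and>
            int (b n) - webster \<beta> n \<in> {-1, 0, 1} \<and>
            int (c n) - webster \<gamma> n \<in> {-1, 0, 1})"
proof -
  define A where "A = webster_count \<alpha>"
  define r where "r N = int N - A N" for N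
  \<comment> \<open>In \<open>L\<close> and \<open>U\<close> the first entry keeps \<open>F\<close>
    close to the count for \<open>\<beta>\<close>, the second keeps \<open>r - F\<close> close to
    the count for \<open>\<gamma>\<close>.\<close>
  define L where "L N = max (webster_count \<beta> (N - 1)) (r N - webster_count \<gamma> (N + 1))" for N
  define U where "U N = min (webster_count \<beta> (N + 1)) (r N - webster_count \<gamma> (N - 1))" for N
  \<comment> \<open>Indeed
    \<open>2 * \<alpha> < \<alpha> + \<gamma> = 1 - \<beta> < 1\<close>.\<close>
  have half: "\<alpha> < 1 / 2" using assms by linarith
  have "mono A" using assms unfolding A_def by (intro mono_webster_count) auto
  have A_step: "A (Suc N) \<le> A N + 1" for N
    using assms webster_count_Suc_le[of \<alpha> N] by (simp add: A_def)
  have r_step: "r (Suc N) - r N \<in> {0, 1}" for N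
    using A_step[of N] monoD[OF \<open>mono A\<close>, of N "Suc N"] by (auto simp: r_def)
  have B_mono: "webster_count \<beta> M \<le> webster_count \<beta> N" if "M \<le> N" for M N
    using mono_webster_count[of \<beta>] assms that by (auto dest: monoD)
  have C_mono: "webster_count \<gamma> M \<le> webster_count \<gamma> N" if "M \<le> N" for M N
    using mono_webster_count[of \<gamma>] assms that by (auto dest: monoD)
  have le: "webster_count \<beta> (N - 1) + webster_count \<gamma> (N - 1) \<le> r N" for N
    using webster_counts_le[of \<beta> \<gamma> \<alpha> N] assms half by (simp add: r_def A_def)
  have ge: "r N \<le> webster_count \<beta> (N + 1) + webster_count \<gamma> (N + 1)" for N
    using webster_counts_ge[of \<beta> \<gamma> \<alpha> N] assms half by (simp add: r_def A_def)
  have B_diff: "webster_count \<beta> (N - 1) - webster_count \<beta> (M + 1) \<le> r N - r M" if "M \<le> N" for M N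
    using webster_count_diff_le[of \<beta> \<gamma> \<alpha> M N] assms half that by (simp add: r_def A_def)
  have C_diff: "webster_count \<gamma> (N - 1) - webster_count \<gamma> (M + 1) \<le> r N - r M" if "M \<le> N" for M N
    using webster_count_diff_le[of \<gamma> \<beta> \<alpha> M N] assms half that by (simp add: r_def A_def)
  have nonneg: "0 \<le> webster_count \<beta> N" "0 \<le> webster_count \<gamma> N" for N
    using B_mono[of 0 N] C_mono[of 0 N] by simp_all
  have "\<exists>F. F 0 = 0 \<and> (\<forall>N. F (Suc N) - F N \<in> {0..r (Suc N) - r N} \<and> L N \<le> F N \<and> F N \<le> U N)"
  proof (rule constrained_path_exists)
    show "r 0 = 0" by (simp add: r_def A_def)
    show "r (Suc N) - r N \<in> {0, 1}" for N by (rule r_step)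
    \<comment> \<open>Four pairings of the entries of max and min: two counts for
      \<open>\<beta>\<close> compare by monotonicity, two for \<open>\<gamma>\<close> by
      \<open>C_diff\<close>, and the mixed pairs by \<open>le\<close> at \<open>N\<close> and
      \<open>ge\<close> at \<open>M\<close>.\<close>
    show "L M \<le> U N" if "M \<le> N" for M N
    proof -
      have "M - 1 \<le> N - 1" "M - 1 \<le> N + 1" "M + 1 \<le> N + 1" using that by auto
      note this[THEN B_mono]
      then show ?thesis using le[of N] ge[of M] C_diff[OF that] unfolding L_def U_def by auto
    qed
    \<comment> \<open>The mirror image under exchanging \<open>F\<close> with \<open>r - F\<close>,
      hence \<open>\<beta>\<close> with \<open>\<gamma>\<close>.\<close>
    show "L N - U M \<le> r N - r M" if "M \<le> N" for M N
    proof -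
      have "M - 1 \<le> N - 1" "M - 1 \<le> N + 1" "M + 1 \<le> N + 1" using that by auto
      note this[THEN C_mono]
      then show ?thesis using le[of N] ge[of M] B_diff[OF that] unfolding L_def U_def by linarith
    qed
    show "L N \<le> r N" for N
      using le[of N] nonneg[of "N - 1"] nonneg[of "N + 1"] unfolding L_def by auto
    show "0 \<le> U N" for N
      using le[of N] nonneg[of "N - 1"] nonneg[of "N + 1"] unfolding U_def by auto
  qed
  then obtain F where F0: "F 0 = 0"
    and F_step: "\<And>N. F (Suc N) - F N \<in> {0..r (Suc N) - r N}"
    and F_bounds: "\<And>N. L N \<le> F N" "\<And>N. F N \<le> U N" by blast
  define G where "G N = r N - F N" for N
  have "\<exists>b. strict_mono_on {1..} b \<and> b ` {1..} = {N. 1 \<le> N \<and> F (N - 1) < F N} \<and>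
      (\<forall>n\<ge>1. int (b n) - webster \<beta> n \<in> {-1, 0, 1})"
  proof (rule almost_webster_enumeration)
    show "F 0 = 0" by (rule F0)
    show "F (Suc N) - F N \<in> {0, 1}" for N using F_step[of N] r_step[of N] by auto
    show "webster_count \<beta> (N - 1) \<le> F N" for N using F_bounds(1)[of N] by (simp add: L_def)
    show "F N \<le> webster_count \<beta> (N + 1)" for N using F_bounds(2)[of N] by (simp add: U_def)
  qed (use assms in simp)
  then obtain b where b: "strict_mono_on {1..} b" "b ` {1..} = {N. 1 \<le> N \<and> F (N - 1) < F N}"
    "\<forall>n\<ge>1. int (b n) - webster \<beta> n \<in> {-1, 0, 1}" by blast
  have "\<exists>c. strict_mono_on {1..} c \<and> c ` {1..} = {N. 1 \<le> N \<and> G (N - 1) < G N} \<and>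
      (\<forall>n\<ge>1. int (c n) - webster \<gamma> n \<in> {-1, 0, 1})"
  proof (rule almost_webster_enumeration)
    show "G 0 = 0" by (simp add: G_def F0 r_def A_def)
    show "G (Suc N) - G N \<in> {0, 1}" for N using F_step[of N] r_step[of N] by (auto simp: G_def)
    show "webster_count \<gamma> (N - 1) \<le> G N" for N using F_bounds(2)[of N] by (simp add: G_def U_def)
    show "G N \<le> webster_count \<gamma> (N + 1)" for N using F_bounds(1)[of N] by (simp add: G_def L_def)
  qed (use assms in simp)
  then obtain c where c: "strict_mono_on {1..} c" "c ` {1..} = {N. 1 \<le> N \<and> G (N - 1) < G N}"
    "\<forall>n\<ge>1. int (c n) - webster \<gamma> n \<in> {-1, 0, 1}" by blast
  define a where "a n = nat (webster \<alpha> n)" for n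
  have a_enum: "enumerates a A"
    using enumerates_webster[of \<alpha>] assms by (simp add: a_def [abs_def] A_def)
  have A0: "A 0 = 0" by (simp add: A_def)
  have a: "strict_mono_on {1..} a" "a ` {1..} = {N. 1 \<le> N \<and> A (N - 1) < A N}"
    using enumerates_strict_mono_on[of a A, OF a_enum A0 A_step]
      enumerates_image[OF a_enum A0 \<open>mono A\<close>] by blast+
  have a_webster: "\<forall>n\<ge>1. int (a n) = webster \<alpha> n"
    using webster_pos[of \<alpha>] assms by (simp add: a_def less_imp_le)
  \<comment> \<open>\<open>A N + F N + G N = int N\<close> and no summand decreases, so exactly one
    of them jumps at each step.\<close>
  have one: "(A N < A (Suc N) \<or> F N < F (Suc N) \<or> G N < G (Suc N)) \<and>
      \<not> (A N < A (Suc N) \<and> F N < F (Suc N)) \<and> \<not> (A N < A (Suc N) \<and> G N < G (Suc N)) \<and>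
      \<not> (F N < F (Suc N) \<and> G N < G (Suc N))" for N
    using F_step[of N] r_step[of N] by (auto simp: G_def r_def)
  have one': "(A (N - 1) < A N \<or> F (N - 1) < F N \<or> G (N - 1) < G N) \<and>
      \<not> (A (N - 1) < A N \<and> F (N - 1) < F N) \<and> \<not> (A (N - 1) < A N \<and> G (N - 1) < G N) \<and>
      \<not> (F (N - 1) < F N \<and> G (N - 1) < G N)" if "1 \<le> N" for N
    using one[of "N - 1"] that by simp
  have "a ` {1..} \<union> b ` {1..} \<union> c ` {1..} = {1..}" "a ` {1..} \<inter> b ` {1..} = {}"
    "a ` {1..} \<inter> c ` {1..} = {}" "b ` {1..} \<inter> c ` {1..} = {}"
    unfolding a(2) b(2) c(2) using one' by auto
  with a(1) b(1,3) c(1,3) a_webster show ?thesis by blast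
qed

end
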